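(* Let $S=\langle \mathcal{A},\mathbf{G}\rangle$ be a constrained switched system, let $\epsilon>0$, and let $\mathcal{O}_\epsilon$ be a stability oracle (as defined in the context). Then the Stabilization Algorithm (described in the context), run on input $S$ with oracle $\mathcal{O}_\epsilon$, terminates after finitely many iterations, and the constrained switched system it returns is stable.
   Context: **Automata.** Let $\mathcal{A}=\{A_1,\dots,A_m\}\subset\mathbb{R}^{n\times n}$ be a finite set of real matrices. An automaton is a finite directed labelled graph $\mathbf{G}=(V,E)$ in which no node has zero ingoing or zero outgoing degree; each edge is a triple $(v,w,\sigma)\in E$ with $v,w\in V$ and label $\sigma\in\{1,\dots,m\}$ (the label $\sigma$ corresponds to the matrix $A_\sigma$). A word $\sigma_0\sigma_1\dots\sigma_{k-1}$ is accepted by $\mathbf{G}$ if there are nodes $v_0,\dots,v_k\in V$ with $(v_j,v_{j+1},\sigma_j)\in E$ for all $j=0,\dots,k-1$. $\mathbf{G}_k$ denotes the set of accepted words of length $k$, and $\mathbf{G}^*=\bigcup_{k\ge1}\mathbf{G}_k$ is the language recognized by $\mathbf{G}$. $\mathbf{G}_k^\circ$ denotes the set of accepted cycles of length $k$, i.e. closed paths $v_0,\sigma_0,v_1,\dots,\sigma_{k-1},v_k=v_0$ of $\mathbf{G}$, each with its associated word $\sigma_0\dots\sigma_{k-1}$. For a word (or cycle with word) $s=\sigma_0\dots\sigma_{k-1}$, put $A_s=A_{\sigma_{k-1}}\cdots A_{\sigma_1}A_{\sigma_0}$. **Constrained switched system (CSS).** $S=\langle\mathcal{A},\mathbf{G}\rangle$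 is the system $x_{k+1}=A_{\sigma_k}x_k$ where the switching signal satisfies $\sigma_0\dots\sigma_{k-1}\in\mathbf{G}_k$ for all $k$. It is stable if $\lim_{k\to\infty}\|A_{\sigma_{k-1}}\cdots A_{\sigma_0}x_0\|=0$ for every $x_0\in\mathbb{R}^n$ and every infinite switching signal $\sigma_0\sigma_1\dots$ all of whose prefixes are accepted by $\mathbf{G}$. **Constrained joint spectral radius.** $\hat\rho(S)=\lim_{k\to\infty}\hat\rho_k(S)$, where $\hat\rho_k(S)=\sup_{w\in\mathbf{G}_k}\|A_w\|^{1/k}$ and $\|\cdot\|$ is any sub-multiplicative matrix norm. **Oracle.** Given $\epsilon>0$, a stability oracle $\mathcal{O}_\epsilon$ is a map (always returning an answer) that assigns to a CSS $S=\langle\mathcal{A},\mathbf{G}\rangle$ an element of $\{\texttt{Stable}\}\cup\bigcup_{k\ge1}\mathbf{G}_k^\circ$: it returns either $\texttt{Stable}$, in which case $\hat\rho(S)<1$, or, for some $k$, a cycle $c\in\mathbf{G}_k^\circ$ such that $\rho(A_c)^{1/k}>1-\epsilon$, where $\rho(A_c)$ is the spectral radius of $A_c$. **Entropy.** $h^*(\mathbf{G})=\lim_{k\to\infty}\frac1k\log_2|\mathbf{G}_k|$. **Stabilization Algorithm.** Input: a CSS $S=\langle\mathcal{A},\mathbf{G}\rangle$, $\mathbf{G}=(V,E)$. While $\mathcal{O}_\epsilon(S)\neq\texttt{Stable}$: (1) choose an edge $e\in\arg\max\{h^*(\mathbf{G}-e)\mid e\in E,\ e\text{ is an edge of the cycle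 }\mathcal{O}_\epsilon(S)\}$; (2) replace $\mathbf{G}$ by $\mathbf{G}-e$ (and $S$ by $\langle\mathcal{A},\mathbf{G}-e\rangle$). Output: the final $S$. Here $\mathbf{G}-e$ is the automaton obtained from $\mathbf{G}$ by removing the edge $e$. **Conventions.** All notions above are applied verbatim to graphs arising by deleting edges, even if some node is left with zero ingoing or outgoing degree; a supremum over the empty set is $0$ and $\log_2 0=-\infty$. A CSS admitting no infinite switching signal is trivially stable. *)

theory Defs
  imports "HOL-Analysis.Analysis"
begin

text \<open>An edge is a triple of source, target and label.\<close>

type_synonym 'v edge = "'v \<times> 'v \<times> nat"

record 'v automaton =
  nodes :: "'v set"
  edges :: "'v edge set"

definition remove_edge :: "'v automaton \<Rightarrow> 'v edge \<Rightarrow> 'v automaton" where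
  "remove_edge G e = G\<lparr>edges := edges G - {e}\<rparr>"

definition labelled_graph :: "nat \<Rightarrow> 'v automaton \<Rightarrow> bool" where
  "labelled_graph m G \<longleftrightarrow> finite (nodes G) \<and> edges G \<subseteq> nodes G \<times> nodes G \<times> {1..m}"

text \<open>The degree condition is separated from \<^const>\<open>labelled_graph\<close> because it need not
  survive the removal of edges.\<close>

definition is_automaton :: "nat \<Rightarrow> 'v automaton \<Rightarrow> bool" where
  "is_automaton m G \<longleftrightarrow> labelled_graph m G \<and>
     (\<forall>v\<in>nodes G. (\<exists>u \<sigma>. (u, v, \<sigma>) \<in> edges G) \<and> (\<exists>w \<sigma>. (v, w, \<sigma>) \<in> edges G))"

definition labelled_path :: "'v automaton \<Rightarrow> 'v list \<Rightarrow> nat list \<Rightarrow> bool" where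
  "labelled_path G vs s \<longleftrightarrow> length vs = Suc (length s) \<and> set vs \<subseteq> nodes G \<and>
     (\<forall>j<length s. (vs ! j, vs ! Suc j, s ! j) \<in> edges G)"

definition accepted_words :: "'v automaton \<Rightarrow> nat \<Rightarrow> nat list set" where
  "accepted_words G k = {s. length s = k \<and> (\<exists>vs. labelled_path G vs s)}"

text \<open>A cycle is the pair of its node sequence \<open>v\<^sub>0, \<dots>, v\<^sub>k = v\<^sub>0\<close> and its word; it may revisit
  nodes and edges.\<close>

type_synonym 'v cycle = "'v list \<times> nat list"

definition accepted_cycles :: "'v automaton \<Rightarrow> nat \<Rightarrow> 'v cycle set" where
  "accepted_cycles G k = {(vs, s). length s = k \<and> labelled_path G vs s \<and> vs ! k = vs ! 0}"

definition cycle_edges :: "'v cycle \<Rightarrow> 'v edge set" where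
  "cycle_edges c = (case c of (vs, s) \<Rightarrow> {(vs ! j, vs ! Suc j, s ! j) | j. j < length s})"

definition log2_count :: "nat \<Rightarrow> ereal" where
  "log2_count N = (if N = 0 then -\<infinity> else ereal (log 2 (real N)))"

definition entropy :: "'v automaton \<Rightarrow> ereal" where
  "entropy G = lim (\<lambda>k. ereal (1 / real k) * log2_count (card (accepted_words G k)))"

text \<open>The list \<open>mats S\<close> is \<open>[A\<^sub>1, \<dots>, A\<^sub>m]\<close>; labels are counted from 1, list positions from 0.\<close>

record ('v, 'n) css =
  mats :: "(real ^ 'n ^ 'n) list"
  graph :: "'v automaton"

definition label_mat :: "(real ^ 'n ^ 'n) list \<Rightarrow> nat \<Rightarrow> real ^ 'n ^ 'n" where
  "label_mat As \<sigma> = As ! (\<sigma> - 1)"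

text \<open>The matrix of the first letter is the rightmost factor.\<close>

fun word_mat :: "(real ^ 'n ^ 'n) list \<Rightarrow> nat list \<Rightarrow> real ^ 'n ^ 'n" where
  "word_mat As [] = mat 1"
| "word_mat As (\<sigma> # s) = word_mat As s ** label_mat As \<sigma>"

definition is_css :: "('v, 'n::finite) css \<Rightarrow> bool" where
  "is_css S \<longleftrightarrow> is_automaton (length (mats S)) (graph S)"

text \<open>Systems over graphs that may have lost edges.\<close>

definition is_pre_css :: "('v, 'n::finite) css \<Rightarrow> bool" where
  "is_pre_css S \<longleftrightarrow> labelled_graph (length (mats S)) (graph S)"

definition css_remove_edge :: "('v, 'n::finite) css \<Rightarrow> 'v edge \<Rightarrow> ('v, 'n) css" where
  "css_remove_edge S e = S\<lparr>graph := remove_edge (graph S) e\<rparr>"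

definition switching_signal :: "('v, 'n::finite) css \<Rightarrow> (nat \<Rightarrow> nat) \<Rightarrow> bool" where
  "switching_signal S \<sigma> \<longleftrightarrow> (\<forall>k. map \<sigma> [0..<k] \<in> accepted_words (graph S) k)"

definition css_stable :: "('v, 'n::finite) css \<Rightarrow> bool" where
  "css_stable S \<longleftrightarrow> (\<forall>x0 \<sigma>. switching_signal S \<sigma> \<longrightarrow>
     (\<lambda>k. norm (word_mat (mats S) (map \<sigma> [0..<k]) *v x0)) \<longlonglongrightarrow> 0)"

definition submult_matrix_norm :: "(real ^ 'n ^ 'n \<Rightarrow> real) \<Rightarrow> bool" where
  "submult_matrix_norm N \<longleftrightarrow>
     (\<forall>A. 0 \<le> N A) \<and> (\<forall>A. N A = 0 \<longleftrightarrow> A = 0) \<and>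
     (\<forall>c A. N (c *\<^sub>R A) = \<bar>c\<bar> * N A) \<and>
     (\<forall>A B. N (A + B) \<le> N A + N B) \<and>
     (\<forall>A B. N (A ** B) \<le> N A * N B)"

text \<open>The case distinction fixes the supremum over the empty set to be 0.\<close>

definition cjsr_k :: "(real ^ 'n ^ 'n \<Rightarrow> real) \<Rightarrow> ('v, 'n::finite) css \<Rightarrow> nat \<Rightarrow> real" where
  "cjsr_k N S k =
     (if accepted_words (graph S) k = {} then 0
      else (SUP w\<in>accepted_words (graph S) k. root k (N (word_mat (mats S) w))))"

definition cjsr :: "(real ^ 'n ^ 'n \<Rightarrow> real) \<Rightarrow> ('v, 'n::finite) css \<Rightarrow> real" where
  "cjsr N S = lim (cjsr_k N S)"

definition complex_spectrum :: "real ^ 'n ^ 'n \<Rightarrow> complex set" where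
  "complex_spectrum A =
     {z. \<exists>v::complex ^ 'n. v \<noteq> 0 \<and> (\<chi> i j. complex_of_real (A $ i $ j)) *v v = z *s v}"

definition spectral_radius :: "real ^ 'n ^ 'n \<Rightarrow> real" where
  "spectral_radius A = Max (cmod ` complex_spectrum A)"

datatype 'v answer = Stable | Cycle "'v cycle"

definition stability_oracle ::
    "(real ^ 'n ^ 'n \<Rightarrow> real) \<Rightarrow> real \<Rightarrow> (('v, 'n::finite) css \<Rightarrow> 'v answer) \<Rightarrow> bool" where
  "stability_oracle N \<epsilon> Orc \<longleftrightarrow> (\<forall>S. is_pre_css S \<longrightarrow>
     (case Orc S of
        Stable \<Rightarrow> cjsr N S < 1
      | Cycle c \<Rightarrow> (\<exists>k\<ge>1. c \<in> accepted_cycles (graph S) k \<and>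
          root k (spectral_radius (word_mat (mats S) (snd c))) > 1 - \<epsilon>)))"

text \<open>One iteration of the loop. It is a relation because the maximiser need not be unique.\<close>

definition stab_step ::
    "(('v, 'n::finite) css \<Rightarrow> 'v answer) \<Rightarrow> ('v, 'n) css \<Rightarrow> ('v, 'n) css \<Rightarrow> bool" where
  "stab_step Orc S S' \<longleftrightarrow> (\<exists>c e. Orc S = Cycle c \<and>
     is_arg_max (\<lambda>e. entropy (remove_edge (graph S) e))
       (\<lambda>e. e \<in> edges (graph S) \<and> e \<in> cycle_edges c) e \<and>
     S' = css_remove_edge S e)"

text \<open>However ties are resolved, there is no infinite run, and the loop body can always be
  executed as long as the loop condition holds.\<close>

definition stab_terminates ::
    "(('v, 'n::finite) css \<Rightarrow> 'v answer) \<Rightarrow> ('v, 'n) css \<Rightarrow> bool" where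
  "stab_terminates Orc S \<longleftrightarrow>
     \<not> (\<exists>T. T 0 = S \<and> (\<forall>i::nat. stab_step Orc (T i) (T (Suc i)))) \<and>
     (\<forall>T. (stab_step Orc)\<^sup>*\<^sup>* S T \<longrightarrow> Orc T \<noteq> Stable \<longrightarrow> (\<exists>T'. stab_step Orc T T'))"

definition stab_returns ::
    "(('v, 'n::finite) css \<Rightarrow> 'v answer) \<Rightarrow> ('v, 'n) css \<Rightarrow> ('v, 'n) css \<Rightarrow> bool" where
  "stab_returns Orc S T \<longleftrightarrow> (stab_step Orc)\<^sup>*\<^sup>* S T \<and> Orc T = Stable"

end

theory Submission imports Defs begin

text \<open>Every iteration deletes one of the finitely many edges, and the cycle returned by the oracle
  has at least one edge, so the loop can neither run forever nor get stuck. On exit the constrained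
  joint spectral radius is below 1. The largest norm of a product of length \<open>k\<close> is submultiplicative
  in \<open>k\<close>, so by Fekete's argument the limit defining the radius exists and these norms decay
  geometrically, which forces every trajectory to 0.\<close>

section \<open>Submultiplicative sequences and Fekete's argument\<close>

lemma submultiplicative_geometric_bound:
  fixes a :: "nat \<Rightarrow> real"
  assumes nonneg: "\<And>n. 0 \<le> a n" and submult: "\<And>m n. a (m + n) \<le> a m * a n"
    and "k > 0" "r > 0" "a k \<le> r ^ k"
  obtains C where "C > 0" "\<And>n. a n \<le> C * r ^ n"
proof
  \<comment> \<open>With n = k * q + s and s < k, the q full blocks cost at most r ^ (k * q) and the
    rest costs a s. The sum dominates a s / r ^ s for every remainder s at once; the summand 1 keeps
    C positive even if all these terms vanish.\<close>
  define C where "C = 1 + (\<Sum>s<k. a s / r ^ s)"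
  have q: "a (k * q + s) \<le> r ^ (k * q) * a s" for q s
  proof (induction q)
    case (Suc q)
    have "a (k * Suc q + s) \<le> a k * a (k * q + s)"
      using submult[of k "k * q + s"] by (simp add: algebra_simps)
    also have "\<dots> \<le> r ^ k * (r ^ (k * q) * a s)"
      using Suc nonneg assms by (intro mult_mono) auto
    finally show ?case by (simp add: power_add algebra_simps)
  qed simp
  show "C > 0"
    unfolding C_def using nonneg \<open>r > 0\<close> by (intro add_pos_nonneg sum_nonneg) auto
  show "a n \<le> C * r ^ n" for n
  proof -
    let ?s = "n mod k"
    have "a ?s / r ^ ?s \<le> (\<Sum>s<k. a s / r ^ s)"
      using nonneg \<open>r > 0\<close> \<open>k > 0\<close> by (intro member_le_sum) auto
    then have "a ?s / r ^ ?s \<le> C"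
      by (simp add: C_def)
    then have "a ?s \<le> C * r ^ ?s"
      using \<open>r > 0\<close> by (simp add: divide_le_eq)
    then have "r ^ (k * (n div k)) * a ?s \<le> r ^ (k * (n div k)) * (C * r ^ ?s)"
      using \<open>r > 0\<close> by (intro mult_left_mono) auto
    also have "\<dots> = C * r ^ (k * (n div k) + ?s)"
      by (simp only: power_add mult_ac)
    finally show ?thesis
      using q[of "n div k" ?s] by simp
  qed
qed

text \<open>The limit is the infimum \<open>L\<close> over n \<ge> 1, so the lower bound is
  immediate. If b > L, a single index k has its root below b, and the geometric bound spreads this
  to all large n, up to a constant whose n-th root tends to 1.\<close>

lemma submultiplicative_root_convergent:
  fixes a :: "nat \<Rightarrow> real"
  assumes nonneg: "\<And>n. 0 \<le> a n" and submult: "\<And>m n. a (m + n) \<le> a m * a n"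
  shows "convergent (\<lambda>n. root n (a n))"
proof -
  define L where "L = (INF n\<in>{1..}. root n (a n))"
  have bdd: "bdd_below ((\<lambda>n. root n (a n)) ` {1..})"
    using nonneg by (intro bdd_belowI[of _ 0]) auto
  have "(\<lambda>n. root n (a n)) \<longlonglongrightarrow> L"
  proof (rule order_tendstoI)
    fix b assume "b < L"
    have "L \<le> root n (a n)" if "n \<ge> 1" for n
      unfolding L_def using that by (intro cINF_lower[OF bdd]) auto
    then show "\<forall>\<^sub>F n in sequentially. b < root n (a n)"
      using \<open>b < L\<close> by (intro eventually_sequentiallyI[of 1]) force
  next
    fix b assume "L < b"
    then obtain k where k: "k \<ge> 1" "root k (a k) < b"
      unfolding L_def by (subst (asm) cINF_less_iff[OF _ bdd]) auto
    \<comment> \<open>The midpoint leaves room below b to absorb root n C. It is positive even when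
      root k (a k) = 0, as the geometric bound requires.\<close>
    define r where "r = (root k (a k) + b) / 2"
    have r: "root k (a k) < r" "r < b" "r > 0"
      using k(2) real_root_ge_zero[OF nonneg[of k], of k] by (simp_all add: r_def)
    have "a k = root k (a k) ^ k"
      using k nonneg by simp
    also have "\<dots> \<le> r ^ k"
      using r real_root_ge_zero[OF nonneg] by (intro power_mono) simp_all
    finally obtain C where C: "C > 0" "\<And>n. a n \<le> C * r ^ n"
      using submultiplicative_geometric_bound[of a k r] nonneg submult k r by auto
    have "(\<lambda>n. root n C * r) \<longlonglongrightarrow> 1 * r"
      using C by (intro tendsto_intros LIMSEQ_root_const)
    then have "\<forall>\<^sub>F n in sequentially. root n C * r < b"
      using r by (intro order_tendstoD) auto
    then show "\<forall>\<^sub>F n in sequentially. root n (a n) < b"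
      using eventually_gt_at_top[of 0]
    proof eventually_elim
      case (elim n)
      have "root n (a n) \<le> root n (C * r ^ n)"
        using C elim by simp
      also have "\<dots> = root n C * r"
        using r elim by (simp add: real_root_mult real_root_power_cancel)
      finally show ?case using elim by simp
    qed
  qed
  then show ?thesis by (auto simp: convergent_def)
qed

section \<open>Accepted words and the largest norm of their products\<close>

lemma accepted_words_append:
  assumes "w \<in> accepted_words G (m + n)"
  obtains u v where "w = u @ v" "u \<in> accepted_words G m" "v \<in> accepted_words G n"
proof
  from assms obtain vs where len: "length w = m + n" and p: "labelled_path G vs w"
    by (auto simp: accepted_words_def)
  show "w = take m w @ drop m w" by simp
  \<comment> \<open>A path has one node more than letters, so both halves keep the node at position
    m.\<close>
  have "labelled_path G (take (Suc m) vs) (take m w)"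
    using p len by (auto simp: labelled_path_def dest: in_set_takeD)
  then show "take m w \<in> accepted_words G m"
    using len by (auto simp: accepted_words_def)
  have "labelled_path G (drop m vs) (drop m w)"
    using p len by (auto simp: labelled_path_def dest: in_set_dropD)
  then show "drop m w \<in> accepted_words G n"
    using len by (auto simp: accepted_words_def)
qed

lemma finite_accepted_words:
  assumes "labelled_graph m G"
  shows "finite (accepted_words G k)"
proof (rule finite_subset)
  show "accepted_words G k \<subseteq> {s. set s \<subseteq> {1..m} \<and> length s = k}"
    using assms by (fastforce simp: accepted_words_def labelled_path_def labelled_graph_def
        in_set_conv_nth)
  show "finite {s. set s \<subseteq> {1..m} \<and> length s = k}"
    by (rule finite_lists_length_eq) simp
qed

lemma word_mat_append: "word_mat As (u @ v) = word_mat As v ** word_mat As u"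
  by (induction u) (auto simp: matrix_mul_assoc)

text \<open>Without the k-th root of \<open>cjsr_k\<close> the quantity is submultiplicative in k.
  The value 0 when no word is accepted agrees with the convention in \<open>cjsr_k\<close>.\<close>

definition max_word_norm :: "(real ^ 'n ^ 'n \<Rightarrow> real) \<Rightarrow> ('v, 'n::finite) css \<Rightarrow> nat \<Rightarrow> real" where
  "max_word_norm N S k =
     (if accepted_words (graph S) k = {} then 0
      else Max ((\<lambda>w. N (word_mat (mats S) w)) ` accepted_words (graph S) k))"

lemma word_norm_le_max:
  assumes "is_pre_css S" "w \<in> accepted_words (graph S) k"
  shows "N (word_mat (mats S) w) \<le> max_word_norm N S k"
  using assms finite_accepted_words[of "length (mats S)" "graph S" k]
  by (auto simp: max_word_norm_def is_pre_css_def)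

lemma max_word_norm_nonneg:
  assumes "submult_matrix_norm N" "is_pre_css S"
  shows "0 \<le> max_word_norm N S k"
proof (cases "accepted_words (graph S) k = {}")
  case False
  then obtain w where "w \<in> accepted_words (graph S) k" by auto
  then show ?thesis
    using assms word_norm_le_max[of S w k N] unfolding submult_matrix_norm_def
    by (meson order_trans)
qed (simp add: max_word_norm_def)

lemma max_word_norm_submult:
  assumes "submult_matrix_norm N" "is_pre_css S"
  shows "max_word_norm N S (m + n) \<le> max_word_norm N S m * max_word_norm N S n"
proof (cases "accepted_words (graph S) (m + n) = {}")
  case True
  then show ?thesis
    using max_word_norm_nonneg[OF assms] by (simp add: max_word_norm_def[of N S "m + n"])
next
  case False
  have "N (word_mat (mats S) w) \<le> max_word_norm N S m * max_word_norm N S n"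
    if w: "w \<in> accepted_words (graph S) (m + n)" for w
  proof -
    obtain u v where uv: "w = u @ v" "u \<in> accepted_words (graph S) m"
      "v \<in> accepted_words (graph S) n"
      using accepted_words_append[OF w] .
    \<comment> \<open>The factors appear in reverse order because the matrix of the first letter
      stands rightmost.\<close>
    have "N (word_mat (mats S) w) \<le> N (word_mat (mats S) v) * N (word_mat (mats S) u)"
      using assms(1) by (simp add: uv word_mat_append submult_matrix_norm_def)
    also have "\<dots> \<le> max_word_norm N S n * max_word_norm N S m"
      using uv assms by (intro mult_mono word_norm_le_max max_word_norm_nonneg)
        (auto simp: submult_matrix_norm_def)
    finally show ?thesis by (simp add: mult.commute)
  qed
  then show ?thesis
    using False finite_accepted_words[of "length (mats S)" "graph S" "m + n"] assms(2)
    by (auto simp: max_word_norm_def[of N S "m + n"] is_pre_css_def)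
qed

text \<open>For k > 0 the root is monotone, so it commutes with the maximum over the finite set of
  words, where supremum and maximum coincide. For k = 0 both sides vanish, since
  \<open>root 0\<close> is constantly 0.\<close>

lemma cjsr_k_eq_root:
  assumes "is_pre_css S"
  shows "cjsr_k N S k = root k (max_word_norm N S k)"
proof (cases "accepted_words (graph S) k = {} \<or> k = 0")
  case True
  then show ?thesis
    by (cases "accepted_words (graph S) k = {}") (simp_all add: cjsr_k_def max_word_norm_def)
next
  case False
  let ?W = "accepted_words (graph S) k"
  have fin: "finite ?W"
    using assms finite_accepted_words by (auto simp: is_pre_css_def)
  have "mono (root k)"
    using False by (intro monoI) simp
  then have "root k (Max ((\<lambda>w. N (word_mat (mats S) w)) ` ?W))
      = Max (root k ` (\<lambda>w. N (word_mat (mats S) w)) ` ?W)"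
    using fin False by (intro mono_Max_commute) auto
  then show ?thesis
    using fin False by (simp add: cjsr_k_def max_word_norm_def cSup_eq_Max image_image)
qed

lemma max_word_norm_tendsto_0:
  assumes "submult_matrix_norm N" "is_pre_css S" "cjsr N S < 1"
  shows "max_word_norm N S \<longlonglongrightarrow> 0"
proof -
  let ?a = "max_word_norm N S"
  note nonneg = max_word_norm_nonneg[OF assms(1,2)]
  note submult = max_word_norm_submult[OF assms(1,2)]
  have eq: "cjsr_k N S = (\<lambda>k. root k (?a k))"
    using cjsr_k_eq_root[OF assms(2)] by auto
  \<comment> \<open>\<open>cjsr\<close> is defined by \<open>lim\<close>, so its value is known to
    be the actual limit only after convergence has been shown.\<close>
  have "convergent (\<lambda>k. root k (?a k))"
    using nonneg submult by (rule submultiplicative_root_convergent)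
  then have "(\<lambda>k. root k (?a k)) \<longlonglongrightarrow> cjsr N S"
    unfolding cjsr_def eq by (simp add: convergent_LIMSEQ_iff)
  then have "\<forall>\<^sub>F k in sequentially. root k (?a k) < 1 \<and> 0 < k"
    using assms(3) by (intro eventually_conj order_tendstoD eventually_gt_at_top)
  then obtain k where k: "root k (?a k) < 1" "k > 0"
    by (auto simp: eventually_sequentially)
  \<comment> \<open>The bound 1/2 keeps r positive if the root is 0, while r stays below 1.\<close>
  define r where "r = max (1/2) (root k (?a k))"
  have r: "0 < r" "r < 1" "root k (?a k) \<le> r"
    using k by (auto simp: r_def)
  have "?a k = root k (?a k) ^ k"
    using k nonneg by simp
  also have "\<dots> \<le> r ^ k"
    using r real_root_ge_zero[OF nonneg] by (intro power_mono) simp_all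
  finally obtain C where C: "C > 0" "\<And>n. ?a n \<le> C * r ^ n"
    using submultiplicative_geometric_bound[of ?a k r] nonneg submult k r by auto
  have "(\<lambda>n. C * r ^ n) \<longlonglongrightarrow> C * 0"
    using r by (intro tendsto_intros LIMSEQ_realpow_zero) auto
  then show ?thesis
    using C nonneg
    by (intro tendsto_sandwich[of "\<lambda>_. 0" ?a _ "\<lambda>n. C * r ^ n"]) auto
qed

section \<open>From an arbitrary submultiplicative norm to trajectories\<close>

definition unit_mat :: "'n \<Rightarrow> 'n \<Rightarrow> real ^ 'n ^ 'n::finite" where
  "unit_mat i j = (\<chi> k l. if k = i \<and> l = j then 1 else 0)"

lemma unit_mat_sandwich: "unit_mat i i ** A ** unit_mat j i = (A $ i $ j) *\<^sub>R unit_mat i i"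
proof -
  have "(\<Sum>l\<in>UNIV. (\<Sum>p\<in>UNIV. (if k = i \<and> p = i then 1 else 0) * A $ p $ l)
      * (if l = j \<and> q = i then 1 else 0)) = A $ i $ j * (if k = i \<and> q = i then 1 else 0)"
    for k q
    by (cases "k = i"; cases "q = i") (simp_all add: if_distrib if_distribR cong: if_cong)
  then show ?thesis
    by (simp add: vec_eq_iff matrix_matrix_mult_def unit_mat_def)
qed

text \<open>This takes the place of the equivalence of norms. Multiplying A by matrix units on both
  sides isolates one entry as a multiple of \<open>unit_mat i i\<close>; submultiplicativity bounds
  the norm of that product, and the positive factor N (\<open>unit_mat i i\<close>) cancels.\<close>

lemma entry_le_submult_norm:
  assumes "submult_matrix_norm N"
  shows "\<bar>A $ i $ j\<bar> \<le> N (unit_mat j i) * N A"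
proof -
  have N: "\<And>A. 0 \<le> N A" "\<And>A. N A = 0 \<longleftrightarrow> A = 0" "\<And>c A. N (c *\<^sub>R A) = \<bar>c\<bar> * N A"
    "\<And>A B. N (A ** B) \<le> N A * N B"
    using assms by (auto simp: submult_matrix_norm_def)
  have "unit_mat i i $ i $ i = 1"
    by (simp add: unit_mat_def)
  then have "unit_mat i i \<noteq> 0" by auto
  then have pos: "N (unit_mat i i) > 0"
    using N(1,2) by (metis order_le_less)
  have "\<bar>A $ i $ j\<bar> * N (unit_mat i i) = N (unit_mat i i ** A ** unit_mat j i)"
    by (simp add: unit_mat_sandwich N(3))
  also have "\<dots> \<le> N (unit_mat i i ** A) * N (unit_mat j i)" by (rule N)
  also have "\<dots> \<le> N (unit_mat i i) * N A * N (unit_mat j i)"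
    using N by (intro mult_right_mono) auto
  finally have "\<bar>A $ i $ j\<bar> * N (unit_mat i i) \<le> (N (unit_mat j i) * N A) * N (unit_mat i i)"
    by (simp add: mult_ac)
  then show ?thesis using pos by simp
qed

lemma tendsto_mat_0_if_submult_norm:
  assumes "submult_matrix_norm N" "((\<lambda>k. N (M k)) \<longlongrightarrow> 0) F"
  shows "(M \<longlongrightarrow> 0) F"
proof -
  have "((\<lambda>k. M k $ i $ j) \<longlongrightarrow> 0) F" for i j
  proof (rule Lim_null_comparison)
    show "\<forall>\<^sub>F k in F. norm (M k $ i $ j) \<le> N (unit_mat j i) * N (M k)"
      using entry_le_submult_norm[OF assms(1)] by simp
    show "((\<lambda>k. N (unit_mat j i) * N (M k)) \<longlongrightarrow> 0) F"
      using tendsto_mult_right_zero[OF assms(2)] .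
  qed
  then show ?thesis
    by (intro vec_tendstoI) simp
qed

lemma css_stable_if_cjsr_less_1:
  assumes "submult_matrix_norm N" "is_pre_css S" "cjsr N S < 1"
  shows "css_stable S"
  unfolding css_stable_def
proof (intro allI impI)
  fix x0 \<sigma> assume \<sigma>: "switching_signal S \<sigma>"
  let ?M = "\<lambda>k. word_mat (mats S) (map \<sigma> [0..<k])"
  have "(\<lambda>k. N (?M k)) \<longlonglongrightarrow> 0"
  proof (rule tendsto_sandwich[OF _ _ tendsto_const max_word_norm_tendsto_0[OF assms]])
    show "\<forall>\<^sub>F k in sequentially. 0 \<le> N (?M k)"
      using assms(1) by (simp add: submult_matrix_norm_def)
    show "\<forall>\<^sub>F k in sequentially. N (?M k) \<le> max_word_norm N S k"
      using \<sigma> assms(2)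
      by (intro always_eventually allI word_norm_le_max) (auto simp: switching_signal_def)
  qed
  then have "?M \<longlonglongrightarrow> 0"
    by (rule tendsto_mat_0_if_submult_norm[OF assms(1)])
  \<comment> \<open>Written out as finite sums of entries, the matrix-vector product is covered by
    the standard limit rules.\<close>
  then have "(\<lambda>k. \<chi> i. \<Sum>j\<in>UNIV. ?M k $ i $ j * x0 $ j) \<longlonglongrightarrow> (\<chi> i. \<Sum>j\<in>UNIV. 0 $ i $ j * x0 $ j)"
    by (intro tendsto_intros)
  then have "(\<lambda>k. ?M k *v x0) \<longlonglongrightarrow> 0 *v x0"
    by (simp only: matrix_vector_mult_def)
  then show "(\<lambda>k. norm (?M k *v x0)) \<longlonglongrightarrow> 0"
    by (simp add: tendsto_norm_zero)
qed

section \<open>Invariant, progress and termination of the loop\<close>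

lemma stab_step_is_pre_css: "stab_step Orc S S' \<Longrightarrow> is_pre_css S \<Longrightarrow> is_pre_css S'"
  by (auto simp: stab_step_def is_pre_css_def css_remove_edge_def remove_edge_def
      labelled_graph_def)

text \<open>The loop invariant is \<open>is_pre_css\<close>, since deleting an edge can destroy the
  degree condition in \<open>is_css\<close>. The oracle's guarantee is available for every such
  system.\<close>

lemma stab_step_rtranclp_is_pre_css:
  "(stab_step Orc)\<^sup>*\<^sup>* S T \<Longrightarrow> is_pre_css S \<Longrightarrow> is_pre_css T"
  by (induction rule: rtranclp_induct) (auto intro: stab_step_is_pre_css)

lemma finite_edges:
  assumes "is_pre_css S"
  shows "finite (edges (graph S))"
proof (rule finite_subset)
  show "edges (graph S) \<subseteq> nodes (graph S) \<times> nodes (graph S) \<times> {1..length (mats S)}"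
    using assms by (simp add: is_pre_css_def labelled_graph_def)
  show "finite (nodes (graph S) \<times> nodes (graph S) \<times> {1..length (mats S)})"
    using assms by (simp add: is_pre_css_def labelled_graph_def)
qed

lemma stab_step_card_edges:
  assumes "stab_step Orc S S'" "is_pre_css S"
  shows "card (edges (graph S')) < card (edges (graph S))"
proof -
  from assms(1) obtain e where "e \<in> edges (graph S)" "S' = css_remove_edge S e"
    by (auto simp: stab_step_def is_arg_max_def)
  then show ?thesis
    using card_Diff1_less[OF finite_edges[OF assms(2)]]
    by (simp add: css_remove_edge_def remove_edge_def)
qed

lemma no_infinite_stab_run:
  assumes "is_pre_css (T 0)"
  shows "\<not> (\<forall>i::nat. stab_step Orc (T i) (T (Suc i)))"
proof
  assume step: "\<forall>i. stab_step Orc (T i) (T (Suc i))"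
  have pre: "is_pre_css (T i)" for i
    by (induction i) (use assms step stab_step_is_pre_css in blast)+
  have "card (edges (graph (T i))) + i \<le> card (edges (graph (T 0)))" for i
  proof (induction i)
    case (Suc i)
    moreover have "card (edges (graph (T (Suc i)))) < card (edges (graph (T i)))"
      using stab_step_card_edges step pre by blast
    ultimately show ?case by simp
  qed simp
  \<comment> \<open>After one step more than there were edges at the start, the bound is
    violated.\<close>
  from this[of "Suc (card (edges (graph (T 0))))"] show False by simp
qed

text \<open>The oracle's cycle has length at least 1, so its first edge is a candidate for deletion.
  The candidates are finite in number and their entropies lie in the linear order
  \<open>ereal\<close>, so a maximiser exists.\<close>

lemma stab_step_exists:
  assumes "stability_oracle N \<epsilon> Orc" "is_pre_css S" "Orc S \<noteq> Stable"
  shows "\<exists>S'. stab_step Orc S S'"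
proof -
  obtain c where c: "Orc S = Cycle c"
    using assms(3) by (cases "Orc S") auto
  then have "\<exists>k\<ge>1. c \<in> accepted_cycles (graph S) k"
    using assms(1)[unfolded stability_oracle_def, rule_format, OF assms(2)] by auto
  then obtain vs s where vs: "c = (vs, s)" "labelled_path (graph S) vs s" "length s \<ge> 1"
    by (auto simp: accepted_cycles_def)
  let ?f = "\<lambda>e. entropy (remove_edge (graph S) e)"
  let ?E = "{e. e \<in> edges (graph S) \<and> e \<in> cycle_edges c}"
  have "0 < length s"
    using vs(3) by linarith
  then have "(vs ! 0, vs ! Suc 0, s ! 0) \<in> ?E"
    using vs(1,2) unfolding cycle_edges_def labelled_path_def by blast
  then have "?E \<noteq> {}" by blast
  moreover have fin: "finite ?E"
    using finite_edges[OF assms(2)] by simp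
  ultimately have "Max (?f ` ?E) \<in> ?f ` ?E"
    by (intro Max_in) auto
  then obtain e where e: "e \<in> ?E" "Max (?f ` ?E) = ?f e" by blast
  have "?f e' \<le> ?f e" if "e' \<in> ?E" for e'
    using fin that unfolding e(2)[symmetric] by (intro Max_ge) auto
  then have "is_arg_max ?f (\<lambda>e. e \<in> edges (graph S) \<and> e \<in> cycle_edges c) e"
    using e(1) by (simp add: is_arg_max_linorder)
  then show ?thesis
    using c unfolding stab_step_def by blast
qed

theorem theorem1:
  fixes S :: "('v, 'n::finite) css"
    and N :: "real ^ 'n ^ 'n \<Rightarrow> real"
    and \<epsilon> :: real
    and Orc :: "('v, 'n) css \<Rightarrow> 'v answer"
  assumes "is_css S"
    and "submult_matrix_norm N"
    and "\<epsilon> > 0"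
    and "stability_oracle N \<epsilon> Orc"
  shows "stab_terminates Orc S \<and> (\<forall>T. stab_returns Orc S T \<longrightarrow> css_stable T)"
proof (intro conjI allI impI)
  have pre: "is_pre_css S"
    using assms(1) by (simp add: is_css_def is_pre_css_def is_automaton_def)
  show "stab_terminates Orc S"
    unfolding stab_terminates_def
  proof (intro conjI allI impI)
    show "\<not> (\<exists>T. T 0 = S \<and> (\<forall>i::nat. stab_step Orc (T i) (T (Suc i))))"
      using no_infinite_stab_run pre by blast
    show "\<exists>T'. stab_step Orc T T'" if "(stab_step Orc)\<^sup>*\<^sup>* S T" "Orc T \<noteq> Stable" for T
      using stab_step_exists[OF assms(4)] stab_step_rtranclp_is_pre_css that pre by blast
  qed
  fix T assume "stab_returns Orc S T"
  \<comment> \<open>The invariant carries over to the final system, so the answer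
    \<open>Stable\<close> there yields the bound on its radius.\<close>
  then have T: "is_pre_css T" "Orc T = Stable"
    using pre stab_step_rtranclp_is_pre_css by (auto simp: stab_returns_def)
  then have "cjsr N T < 1"
    using assms(4)[unfolded stability_oracle_def, rule_format, OF T(1)] by simp
  then show "css_stable T"
    using css_stable_if_cjsr_less_1 assms(2) T(1) by blast
qed

end
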